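(* Suppose that the $n\times p$ design matrix $X$ satisfies the coherence property and let $\eta$ be distributed as $\mathcal{CN}(\mathbf{0},\sigma^2 I)$. Let $y=X\beta+\eta$, fix any $t\in(0,1)$, and choose the threshold $$\lambda=\max\Big\{\tfrac{1}{t}\,10\,\mu\sqrt{n\cdot \mathrm{SNR}},\ \tfrac{1}{1-t}\sqrt{2}\Big\}\sqrt{2\sigma^2\log p}.$$ Write $\mu=\mu(X)$ as $\mu=c_1 n^{-1/\gamma}$ for some $c_1>0$ (which may depend on $p$) and $\gamma\in\{0\}\cup[2,\infty)$, and let $c_2=(20c_1)^2$. Then the estimate $\widehat{\mathcal S}$ returned by the OST algorithm with threshold $\lambda$ satisfies $\Pr(\widehat{\mathcal S}\neq\mathcal S)\le 6p^{-1}$ provided $p\ge 128$ and $$n>\max\Bigg\{2k\log p,\ \frac{8(1-t)^{-2}}{\mathrm{SNR}_{\min}}\,2k\log p,\ \bigg(\frac{c_2t^{-2}}{\mathrm{MAR}}\,2k\log p\bigg)^{\gamma/2}\Bigg\}$$ (equivalently, the same condition with $\mathrm{SNR}_{\min}$ replaced by $\mathrm{SNR}\cdot\mathrm{MAR}$). Here the probability is with respect to the true model $\mathcal S$ and the noise vector $\eta$.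
   Context: Setting. $k<n\le p$ are positive integers, $X$ is a fixed real- or complex-valued $n\times p$ matrix whose columns $\mathrm{x}_1,\dots,\mathrm{x}_p$ have unit $\ell_2$-norm, and $\log$ is the natural logarithm. The noise $\eta\in\mathbb C^n$ has i.i.d. circularly symmetric complex Gaussian entries of variance $\sigma^2>0$ (so $\mathbb E\|\eta\|_2^2=n\sigma^2$). Signal model. The signal $\beta\in\mathbb C^p$ is $k$-sparse with uniformly random support: there are a fixed vector $z\in\mathbb C^k$ with all entries nonzero and a uniformly random permutation $(\pi_1,\dots,\pi_p)$ of $\{1,\dots,p\}$, independent of $\eta$, with $\beta_{\pi_i}=z_i$ for $i\le k$ and all other entries of $\beta$ equal to $0$. The true model is $\mathcal S=\{i:|\beta_i|>0\}=\{\pi_1,\dots,\pi_k\}$. Coherence. $\mu(X)=\max_{i\ne j}|\langle \mathrm{x}_i,\mathrm{x}_j\rangle|$ (worst-case coherence) and $\nu(X)=\frac1{p-1}\max_i\big|\sum_{j\neq i}\langle \mathrm{x}_i,\mathrm{x}_j\rangle\big|$ (average coherence). $X$ satisfies the coherence property if $\mu(X)\le \frac{0.1}{\sqrt{2\log p}}$ and $\nu(X)\le \frac{\mu(X)}{\sqrt n}$. Signal quantities. $\beta_{\min}=\min_{i\in\mathcal S}|\beta_i|$, $\mathrm{MAR}=\frac{\beta_{\min}^2}{\|\beta\|_2^2/k}$, $\mathrm{SNR}_{\min}=\frac{\beta_{\min}^2}{\mathbb E[\|\eta\|_2^2]/k}$, $\mathrm{SNR}=\frac{\|\beta\|_2^2}{\mathbb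 E[\|\eta\|_2^2]}$. These depend only on $z$, $n$, $\sigma$, not on the random support. OST algorithm (one-step thresholding). Given $X$, $y$ and $\lambda>0$: compute $f=X^{\mathrm H}y$ and output $\widehat{\mathcal S}=\{i\in\{1,\dots,p\}:|f_i|>\lambda\}$. Convention: the value $\gamma=0$ represents the case $\mu(X)=0$ (i.e. $n^{-1/\gamma}$ is read as $0$). *)

theory Defs
  imports "HOL-Probability.Probability" "HOL-Combinatorics.Multiset_Permutations"
begin

section \<open>Coherence of a matrix\<close>

definition cinner :: "complex ^ 'n \<Rightarrow> complex ^ 'n \<Rightarrow> complex" where
  "cinner u v = (\<Sum>i\<in>UNIV. cnj (u $ i) * v $ i)"

definition hermitian_transpose :: "complex ^ 'p ^ 'n \<Rightarrow> complex ^ 'n ^ 'p" where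
  "hermitian_transpose X = (\<chi> i j. cnj (X $ j $ i))"

text \<open>The maximum is over a nonempty set only for matrices with at least two columns.\<close>

definition worst_case_coherence :: "complex ^ 'p ^ 'n \<Rightarrow> real" where
  "worst_case_coherence X =
     Max {cmod (cinner (column i X) (column j X)) | i j. i \<noteq> j}"

definition average_coherence :: "complex ^ 'p ^ 'n \<Rightarrow> real" where
  "average_coherence X =
     1 / (real CARD('p) - 1) *
     Max (range (\<lambda>i. cmod (\<Sum>j\<in>UNIV - {i}. cinner (column i X) (column j X))))"

definition coherence_property :: "complex ^ 'p ^ 'n \<Rightarrow> bool" where
  "coherence_property X \<longleftrightarrow>
     worst_case_coherence X \<le> 0.1 / sqrt (2 * ln (real CARD('p))) \<and>
     average_coherence X \<le> worst_case_coherence X / sqrt (real CARD('n))"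


section \<open>Sparse signals\<close>

text \<open>
  The tuple \<open>(\<pi>\<^sub>1, \<dots>, \<pi>\<^sub>p)\<close> is a list enumerating the index type without repetition, and
  \<open>z \<in> \<complex>\<^sup>k\<close> is a list of length \<open>k\<close>; list positions start at 0. When \<open>\<pi>\<close> has no
  repetitions, the sum below has at most one term.
\<close>

definition sparse_signal :: "complex list \<Rightarrow> 'p list \<Rightarrow> complex ^ 'p" where
  "sparse_signal z \<pi> = (\<chi> j. \<Sum>i | i < length z \<and> \<pi> ! i = j. z ! i)"

definition true_model :: "complex ^ 'p \<Rightarrow> 'p set" where
  "true_model \<beta> = {i. cmod (\<beta> $ i) > 0}"

text \<open>
  The quantities below are functionals of the signal that do not depend on the
  placement of the nonzero entries, so they are defined on the list \<open>z\<close> of these entries; see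
  \<open>signal_energy_sparse_signal\<close> and \<open>signal_min_sparse_signal\<close>. The argument \<open>N\<close> is the
  expected noise energy.
\<close>

definition signal_energy :: "complex list \<Rightarrow> real" where
  "signal_energy z = (\<Sum>i<length z. (cmod (z ! i))\<^sup>2)"

definition signal_min :: "complex list \<Rightarrow> real" where
  "signal_min z = Min (cmod ` set z)"

definition MAR :: "complex list \<Rightarrow> real" where
  "MAR z = (signal_min z)\<^sup>2 / (signal_energy z / real (length z))"

definition SNR_min :: "complex list \<Rightarrow> real \<Rightarrow> real" where
  "SNR_min z N = (signal_min z)\<^sup>2 / (N / real (length z))"

definition SNR :: "complex list \<Rightarrow> real \<Rightarrow> real" where
  "SNR z N = signal_energy z / N"

lemma sparse_signal_nth:
  fixes \<pi> :: "'p::finite list"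
  assumes "\<pi> \<in> permutations_of_set UNIV" "length z \<le> CARD('p)" "i < length z"
  shows "sparse_signal z \<pi> $ (\<pi> ! i) = z ! i"
proof -
  have "distinct \<pi>" "length \<pi> = CARD('p)"
    using assms(1) by (auto simp: permutations_of_set_def distinct_card[symmetric])
  then have "{i'. i' < length z \<and> \<pi> ! i' = \<pi> ! i} = {i}"
    using assms(2,3) by (auto simp: nth_eq_iff_index_eq)
  then show ?thesis
    by (simp add: sparse_signal_def)
qed

lemma sparse_signal_eq_0:
  fixes \<pi> :: "'p::finite list"
  assumes "\<And>i. i < length z \<Longrightarrow> \<pi> ! i \<noteq> j"
  shows "sparse_signal z \<pi> $ j = 0"
proof -
  have "{i. i < length z \<and> \<pi> ! i = j} = {}"
    using assms by auto
  then show ?thesis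
    by (simp only: sparse_signal_def vec_lambda_beta sum.empty)
qed

lemma true_model_sparse_signal:
  fixes \<pi> :: "'p::finite list"
  assumes "\<pi> \<in> permutations_of_set UNIV" "length z \<le> CARD('p)" "0 \<notin> set z"
  shows "true_model (sparse_signal z \<pi>) = (\<lambda>i. \<pi> ! i) ` {..<length z}"
proof (intro equalityI subsetI)
  fix j assume "j \<in> true_model (sparse_signal z \<pi>)"
  then have "sparse_signal z \<pi> $ j \<noteq> 0"
    by (simp add: true_model_def)
  then obtain i where "i < length z" "\<pi> ! i = j"
    using sparse_signal_eq_0[of z \<pi> j] by blast
  then show "j \<in> (\<lambda>i. \<pi> ! i) ` {..<length z}"
    by auto
next
  fix j assume "j \<in> (\<lambda>i. \<pi> ! i) ` {..<length z}"
  then obtain i where i: "i < length z" "j = \<pi> ! i"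
    by auto
  have "z ! i \<noteq> 0"
    using i(1) assms(3) nth_mem by fastforce
  then show "j \<in> true_model (sparse_signal z \<pi>)"
    using sparse_signal_nth[OF assms(1,2) i(1)] i(2) by (simp add: true_model_def)
qed

lemma signal_min_sparse_signal:
  fixes \<pi> :: "'p::finite list"
  assumes "\<pi> \<in> permutations_of_set UNIV" "length z \<le> CARD('p)" "0 \<notin> set z"
  shows "signal_min z =
    Min ((\<lambda>i. cmod (sparse_signal z \<pi> $ i)) ` true_model (sparse_signal z \<pi>))"
proof -
  have "(\<lambda>i. cmod (sparse_signal z \<pi> $ i)) ` true_model (sparse_signal z \<pi>) =
      (\<lambda>i. cmod (z ! i)) ` {..<length z}"
    unfolding true_model_sparse_signal[OF assms] image_image
    by (intro image_cong refl) (simp add: sparse_signal_nth[OF assms(1,2)])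
  also have "\<dots> = cmod ` set z"
    by (auto simp: set_conv_nth)
  finally show ?thesis
    by (simp add: signal_min_def)
qed

lemma signal_energy_sparse_signal:
  fixes \<pi> :: "'p::finite list"
  assumes "\<pi> \<in> permutations_of_set UNIV" "length z \<le> CARD('p)"
  shows "signal_energy z = (norm (sparse_signal z \<pi>))\<^sup>2"
proof -
  have \<pi>: "distinct \<pi>" "length \<pi> = CARD('p)"
    using assms(1) by (auto simp: permutations_of_set_def distinct_card[symmetric])
  have inj: "inj_on (\<lambda>i. \<pi> ! i) {..<length z}"
    using \<pi> assms(2) by (auto simp: inj_on_def nth_eq_iff_index_eq)
  have "(norm (sparse_signal z \<pi>))\<^sup>2 = (\<Sum>j\<in>UNIV. (cmod (sparse_signal z \<pi> $ j))\<^sup>2)"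
    by (simp add: norm_vec_def L2_set_def sum_nonneg)
  also have "\<dots> = (\<Sum>j\<in>(\<lambda>i. \<pi> ! i) ` {..<length z}. (cmod (sparse_signal z \<pi> $ j))\<^sup>2)"
  proof (rule sum.mono_neutral_right)
    show "\<forall>j\<in>UNIV - (\<lambda>i. \<pi> ! i) ` {..<length z}. (cmod (sparse_signal z \<pi> $ j))\<^sup>2 = 0"
    proof
      fix j assume "j \<in> UNIV - (\<lambda>i. \<pi> ! i) ` {..<length z}"
      then have "sparse_signal z \<pi> $ j = 0"
        by (intro sparse_signal_eq_0) auto
      then show "(cmod (sparse_signal z \<pi> $ j))\<^sup>2 = 0"
        by simp
    qed
  qed auto
  also have "\<dots> = (\<Sum>i<length z. (cmod (z ! i))\<^sup>2)"
    by (subst sum.reindex[OF inj]) (simp add: sparse_signal_nth[OF assms])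
  finally show ?thesis
    by (simp add: signal_energy_def)
qed


section \<open>Complex Gaussian noise\<close>

text \<open>
  A circularly symmetric complex Gaussian of variance \<open>\<sigma>\<^sup>2\<close> has independent real and imaginary
  parts, each centred normal of variance \<open>\<sigma>\<^sup>2 / 2\<close>.
\<close>

definition circular_gaussian :: "'a measure \<Rightarrow> real \<Rightarrow> ('a \<Rightarrow> complex) \<Rightarrow> bool" where
  "circular_gaussian M \<sigma> w \<longleftrightarrow>
     distributed M lborel (\<lambda>\<omega>. Re (w \<omega>)) (normal_density 0 (\<sigma> / sqrt 2)) \<and>
     distributed M lborel (\<lambda>\<omega>. Im (w \<omega>)) (normal_density 0 (\<sigma> / sqrt 2)) \<and>
     prob_space.indep_var M borel (\<lambda>\<omega>. Re (w \<omega>)) borel (\<lambda>\<omega>. Im (w \<omega>))"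

definition circular_gaussian_vector :: "'a measure \<Rightarrow> real \<Rightarrow> ('a \<Rightarrow> complex ^ 'n) \<Rightarrow> bool" where
  "circular_gaussian_vector M \<sigma> \<eta> \<longleftrightarrow>
     (\<forall>i. circular_gaussian M \<sigma> (\<lambda>\<omega>. \<eta> \<omega> $ i)) \<and>
     prob_space.indep_vars M (\<lambda>_. borel) (\<lambda>i \<omega>. \<eta> \<omega> $ i) UNIV"

text \<open>
  \<open>prob_space.indep_var\<close> only relates random variables with values in the same type. The set
  families below are the \<open>\<sigma>\<close>-algebras generated by \<open>f\<close> and \<open>g\<close>; \<open>indep_set\<close> includes the
  requirement that they consist of events, i.e. that \<open>f\<close> and \<open>g\<close> are measurable.
\<close>

definition independent_pair ::
  "'a measure \<Rightarrow> 'b measure \<Rightarrow> ('a \<Rightarrow> 'b) \<Rightarrow> 'c measure \<Rightarrow> ('a \<Rightarrow> 'c) \<Rightarrow> bool" where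
  "independent_pair M S f T g \<longleftrightarrow>
     f \<in> space M \<rightarrow> space S \<and> g \<in> space M \<rightarrow> space T \<and>
     prob_space.indep_set M {f -` A \<inter> space M | A. A \<in> sets S} {g -` B \<inter> space M | B. B \<in> sets T}"


section \<open>One-step thresholding\<close>

definition OST :: "complex ^ 'p ^ 'n \<Rightarrow> complex ^ 'n \<Rightarrow> real \<Rightarrow> 'p set" where
  "OST X y lam = {i. cmod ((hermitian_transpose X *v y) $ i) > lam}"

text \<open>\<open>s\<close> is the signal-to-noise ratio and \<open>p\<close> the number of columns.\<close>

definition OST_threshold :: "real \<Rightarrow> real \<Rightarrow> nat \<Rightarrow> nat \<Rightarrow> real \<Rightarrow> real \<Rightarrow> real" where
  "OST_threshold t mu n p s \<sigma> =
     max (1 / t * 10 * mu * sqrt (real n * s)) (1 / (1 - t) * sqrt 2) *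
     sqrt (2 * \<sigma>\<^sup>2 * ln (real p))"

text \<open>
  The lower bound on the number of measurements; \<open>s\<close> stands for the minimum signal-to-noise ratio,
  \<open>m\<close> for the minimum-to-average ratio.
\<close>

definition measurement_bound ::
  "real \<Rightarrow> real \<Rightarrow> real \<Rightarrow> nat \<Rightarrow> nat \<Rightarrow> real \<Rightarrow> real \<Rightarrow> real" where
  "measurement_bound t c2 \<gamma> k p s m =
     Max {2 * real k * ln (real p),
          8 / (1 - t)\<^sup>2 / s * (2 * real k * ln (real p)),
          (c2 / t\<^sup>2 / m * (2 * real k * ln (real p))) powr (\<gamma> / 2)}"

end

theory Submission
  imports Defs
begin

text \<open>
  Since every column has unit norm, the statistic that is thresholded splits as
  \<open>f\<^sub>i = \<beta>\<^sub>i + W\<^sub>i + g\<^sub>i\<close>, where \<open>W\<^sub>i = \<Sum>\<^bsub>j \<noteq> i\<^esub> \<langle>x\<^sub>i, x\<^sub>j\<rangle> \<beta>\<^sub>j\<close> is the interference from the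
  other columns and \<open>g\<^sub>i = \<langle>x\<^sub>i, \<eta>\<rangle>\<close> is the noise. Write \<open>L = log p\<close>. If \<open>\<bar>W\<^sub>i\<bar> \<le> A\<close> and
  \<open>\<bar>g\<^sub>i\<bar> \<le> B\<close> for all \<open>i\<close>, with \<open>A = 10 \<mu> \<parallel>\<beta>\<parallel> \<surd>(2 L)\<close> and \<open>B = 2 \<sigma> \<surd>L\<close>, then the threshold
  \<open>\<lambda> = max (A / t) (B / (1 - t))\<close> is at least \<open>A + B\<close>, so no index off the support is selected,
  and an index on the support is selected as soon as \<open>2 \<lambda> < \<beta>\<^sub>m\<^sub>i\<^sub>n\<close>
  (\<open>OST_eq_true_model\<close>). The inequality \<open>2 \<lambda> < \<beta>\<^sub>m\<^sub>i\<^sub>n\<close> follows from the second and the third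
  lower bound on \<open>n\<close> (\<open>noise_level_lt_signal_min\<close>, \<open>interference_level_lt_signal_min\<close>).
  It remains to bound the probability that some \<open>W\<^sub>i\<close> or some \<open>g\<^sub>i\<close> is too large. This is a union
  bound over \<open>2 p\<close> events, each of which concerns only the permutation or only the noise.

  The interference is a weighted sum \<open>\<Sum>\<^sub>l z\<^sub>l a(\<pi>\<^sub>l)\<close> of numbers drawn without replacement from
  the values \<open>a(j) = \<langle>x\<^sub>i, x\<^sub>j\<rangle>\<close> for \<open>j \<noteq> i\<close> and \<open>a(i) = 0\<close>. Its moment generating function is bounded by induction on
  the number of draws (\<open>sampling_without_replacement_mgf_le\<close>): conditioning on the first
  draw changes the mean of the remaining population by an amount proportional to the deviation of
  that draw from its own mean, so each step contributes one centred bounded variable, to which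
  Hoeffding's lemma applies, and the total is sub-Gaussian with variance proxy at most
  \<open>4 \<mu>\<^sup>2 \<parallel>z\<parallel>\<^sup>2\<close> because at most half of the population is drawn. The average coherence
  bounds the mean of \<open>W\<^sub>i\<close> by \<open>\<mu> \<parallel>z\<parallel>\<close>. The Chernoff bound then gives
  \<open>P(\<bar>W\<^sub>i\<bar> > A) \<le> 4 p\<^sup>-\<^sup>7\<close> (\<open>interference_tail\<close>).

  The noise \<open>g\<^sub>i\<close> is again circularly symmetric of variance \<open>\<sigma>\<^sup>2\<close>, and the same
  Chernoff bound gives \<open>P(\<bar>g\<^sub>i\<bar> > B) \<le> 4 p\<^sup>-\<^sup>2\<close> (\<open>noise_tail\<close>). The sum over all \<open>i\<close> is at
  most \<open>4 p\<^sup>-\<^sup>6 + 4 p\<^sup>-\<^sup>1 \<le> 6 p\<^sup>-\<^sup>1\<close>.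
\<close>


section \<open>Energy and sum of the weights\<close>

lemma signal_energy_Nil [simp]: "signal_energy [] = 0"
  by (simp add: signal_energy_def)

lemma signal_energy_Cons [simp]: "signal_energy (z # zs) = (cmod z)\<^sup>2 + signal_energy zs"
  by (simp add: signal_energy_def sum.lessThan_Suc_shift del: sum.lessThan_Suc)

lemma signal_energy_nonneg: "0 \<le> signal_energy zs"
  by (simp add: signal_energy_def sum_nonneg)

lemma signal_energy_pos:
  assumes "z \<noteq> []" "0 \<notin> set z"
  shows "0 < signal_energy z"
  using assms by (cases z) (auto simp: add_pos_nonneg signal_energy_nonneg)

lemma signal_min_pos:
  assumes "z \<noteq> []" "0 \<notin> set z"
  shows "0 < signal_min z"
  unfolding signal_min_def using assms by (subst Min_gr_iff) auto

lemma cmod_sum_list_le: "(cmod (sum_list zs))\<^sup>2 \<le> real (length zs) * signal_energy zs"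
proof -
  have "cmod (sum_list zs) \<le> (\<Sum>i<length zs. cmod (zs ! i))"
    unfolding sum_list_sum_nth atLeast0LessThan by (rule norm_sum)
  then have "(cmod (sum_list zs))\<^sup>2 \<le> (\<Sum>i<length zs. cmod (zs ! i))\<^sup>2"
    by (intro power_mono) auto
  also have "\<dots> \<le> (\<Sum>i<length zs. (cmod (zs ! i))\<^sup>2) * real (card {..<length zs})"
    by (rule sum_squared_le_sum_of_squares)
  finally show ?thesis
    by (simp add: signal_energy_def mult.commute)
qed


section \<open>Moment generating function of sampling without replacement\<close>

text \<open>
  Hoeffding's lemma for a uniformly random element of \<open>A\<close>: multiplication by \<open>w\<close> and passage to the
  real part turn a complex population in a disc of radius \<open>\<mu>\<close> into a real one in an interval
  of length \<open>2 \<bar>w\<bar> \<mu>\<close>.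
\<close>
lemma uniform_mgf_le:
  fixes a :: "'p \<Rightarrow> complex" and w :: complex
  assumes A: "finite A" "A \<noteq> {}" and bound: "\<And>x. x \<in> A \<Longrightarrow> cmod (a x) \<le> \<mu>"
  shows "(\<Sum>x\<in>A. exp (Re (w * (a x - (\<Sum>y\<in>A. a y) / of_nat (card A)))))
    \<le> real (card A) * exp ((cmod w)\<^sup>2 * \<mu>\<^sup>2 / 2)"
proof -
  let ?c = "(\<Sum>y\<in>A. a y) / of_nat (card A)"
  interpret interval_bounded_random_variable "measure_pmf (pmf_of_set A)"
      "\<lambda>x. Re (w * (a x - ?c))" "- cmod w * \<mu> - Re (w * ?c)" "cmod w * \<mu> - Re (w * ?c)"
  proof unfold_locales
    show "AE x in pmf_of_set A. Re (w * (a x - ?c)) \<in>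
        {- cmod w * \<mu> - Re (w * ?c)..cmod w * \<mu> - Re (w * ?c)}"
    proof (rule AE_pmfI)
      fix x assume "x \<in> set_pmf (pmf_of_set A)"
      then have "cmod (w * a x) \<le> cmod w * \<mu>"
        using A bound by (simp add: norm_mult mult_left_mono)
      then have "\<bar>Re (w * a x)\<bar> \<le> cmod w * \<mu>"
        using abs_Re_le_cmod order_trans by blast
      then show "Re (w * (a x - ?c)) \<in> {- cmod w * \<mu> - Re (w * ?c)..cmod w * \<mu> - Re (w * ?c)}"
        unfolding right_diff_distrib by (auto simp del: times_complex.sel)
    qed
  qed simp
  have "measure_pmf.expectation (pmf_of_set A) (\<lambda>x. Re (w * (a x - ?c))) = Re (w * (\<Sum>x\<in>A. a x - ?c)) / card A"
    unfolding integral_pmf_of_set[OF A(2,1)] by (simp only: sum_distrib_left Re_sum)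
  also have "(\<Sum>x\<in>A. a x - ?c) = 0"
    using A by (simp add: sum_subtractf)
  finally have "measure_pmf.expectation (pmf_of_set A) (\<lambda>x. Re (w * (a x - ?c))) = 0"
    by simp
  from Hoeffdings_lemma_nn_integral_0[OF zero_less_one this]
  have "(\<integral>\<^sup>+x. ennreal (exp (Re (w * (a x - ?c)))) \<partial>pmf_of_set A)
      \<le> ennreal (exp ((cmod w)\<^sup>2 * \<mu>\<^sup>2 / 2))"
    by (simp add: power_mult_distrib mult.commute del: times_complex.sel)
  also have "(\<integral>\<^sup>+x. ennreal (exp (Re (w * (a x - ?c)))) \<partial>pmf_of_set A)
      = ennreal ((\<Sum>x\<in>A. exp (Re (w * (a x - ?c)))) / card A)"
    using A by (simp add: nn_integral_pmf_of_set sum_nonneg divide_ennreal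
        ennreal_of_nat_eq_real_of_nat card_gt_0_iff del: times_complex.sel)
  finally show ?thesis
    using A by (simp add: divide_simps mult.commute card_gt_0_iff del: times_complex.sel)
qed

lemma sum_permutations_of_set_nonempty:
  fixes g :: "'p list \<Rightarrow> real"
  assumes "finite A" "A \<noteq> {}"
  shows "(\<Sum>xs\<in>permutations_of_set A. g xs) =
    (\<Sum>x\<in>A. \<Sum>xs\<in>permutations_of_set (A - {x}). g (x # xs))"
proof -
  have "(\<Sum>xs\<in>permutations_of_set A. g xs) =
      (\<Sum>x\<in>A. \<Sum>xs\<in>(#) x ` permutations_of_set (A - {x}). g xs)"
    unfolding permutations_of_set_nonempty[OF assms(2)]
    by (rule sum.UNION_disjoint) (use assms(1) in auto)
  also have "\<dots> = (\<Sum>x\<in>A. \<Sum>xs\<in>permutations_of_set (A - {x}). g (x # xs))"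
    by (intro sum.cong refl sum.reindex[unfolded o_def]) auto
  finally show ?thesis .
qed

text \<open>
  Let \<open>z\<close> be the first weight, \<open>Z\<close> the sum of the remaining ones, \<open>m = card A\<close> and \<open>c\<close> the mean of \<open>a\<close>
  over \<open>A\<close>. Removing \<open>x\<close> shifts the mean to \<open>c - (a x - c) / (m - 1)\<close>. Hence, after the induction
  hypothesis is applied to the population without \<open>x\<close>, the exponent depends on \<open>x\<close> only through
  \<open>w (a x - c)\<close> with \<open>w = z - Z / (m - 1)\<close>, and averaging over \<open>x\<close> costs
  \<open>\<bar>w\<bar>\<^sup>2 \<mu>\<^sup>2 / 2\<close> by Hoeffding's lemma.

  The number \<open>D\<close> of elements never drawn is the same at each step of the induction. It controls the
  correction to the weights: \<open>\<bar>Z\<bar>\<^sup>2 / (m - 1)\<^sup>2\<close> is at most the remaining energy divided by \<open>D\<close>,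
  so that each draw adds \<open>1 / D\<close> to the factor in front of the energy.
\<close>
lemma sampling_without_replacement_mgf_le:
  fixes a :: "'p \<Rightarrow> complex"
  assumes "finite A" and "\<And>x. x \<in> A \<Longrightarrow> cmod (a x) \<le> \<mu>"
    and "card A = length zs + D" and "0 < D"
  shows "(\<Sum>xs\<in>permutations_of_set A. exp (Re (\<Sum>i<length zs. zs ! i * a (xs ! i))))
    \<le> fact (card A) * exp (Re ((\<Sum>x\<in>A. a x) / of_nat (card A) * sum_list zs)
        + \<mu>\<^sup>2 * (1 + length zs / D) * signal_energy zs)"
  using assms(1-3)
proof (induction zs arbitrary: A)
  case Nil
  then show ?case by simp
next
  case (Cons z zs)
  define m where "m = card A"
  define S where "S = (\<Sum>x\<in>A. a x)"
  define c where "c = S / of_nat m"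
  define Z where "Z = sum_list zs"
  define w where "w = z - Z / of_nat (m - 1)"
  define K where "K = \<mu>\<^sup>2 * (1 + length zs / D) * signal_energy zs"
  have m: "m = Suc (length zs + D)"
    using Cons.prems(3) by (simp add: m_def)
  have A: "A \<noteq> {}"
    using m by (auto simp: m_def)
  have fact_m: "fact m = real m * fact (m - 1)"
    by (simp add: m)
  \<comment> \<open>The exponent after the first draw, with the dependence on \<open>x\<close> isolated in one centred term.\<close>
  have split: "z * a x + (S - a x) / of_nat (m - 1) * Z = c * (z + Z) + w * (a x - c)" for x
  proof -
    define q :: complex where "q = of_nat (length zs + D)"
    have q: "of_nat m = q + 1" "of_nat (m - 1) = q"
      by (simp_all add: m q_def)
    have "q \<noteq> 0"
      using \<open>0 < D\<close> unfolding q_def of_nat_eq_0_iff by simp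
    moreover have "S = c * (q + 1)"
      unfolding c_def q(1)[symmetric] by (simp add: m del: of_nat_Suc)
    ultimately show ?thesis
      unfolding w_def q by (simp add: field_simps)
  qed
  have IH: "(\<Sum>xs\<in>permutations_of_set (A - {x}). exp (Re (\<Sum>i<length zs. zs ! i * a (xs ! i))))
      \<le> fact (m - 1) * exp (Re ((S - a x) / of_nat (m - 1) * Z) + K)" if "x \<in> A" for x
  proof -
    have "(\<Sum>y\<in>A - {x}. a y) = S - a x" "card (A - {x}) = m - 1"
      using that Cons.prems(1) by (simp_all add: S_def m_def sum_diff1)
    with Cons.IH[of "A - {x}"] Cons.prems show ?thesis
      using m by (simp add: Z_def K_def)
  qed
  have w: "(cmod w)\<^sup>2 / 2 \<le> (cmod z)\<^sup>2 + signal_energy zs / D"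
  proof -
    have "cmod w \<le> cmod z + cmod Z / real (m - 1)"
      unfolding w_def by (rule order_trans[OF norm_triangle_ineq4]) (simp add: norm_divide)
    then have "(cmod w)\<^sup>2 \<le> (cmod z + cmod Z / real (m - 1))\<^sup>2"
      by (intro power_mono) auto
    also have "\<dots> \<le> 2 * (cmod z)\<^sup>2 + 2 * (cmod Z / real (m - 1))\<^sup>2"
      using sum_squares_bound[of "cmod z" "cmod Z / real (m - 1)"] by (simp add: power2_sum)
    finally have "(cmod w)\<^sup>2 / 2 \<le> (cmod z)\<^sup>2 + (cmod Z / real (m - 1))\<^sup>2"
      by simp
    also have "(cmod Z / real (m - 1))\<^sup>2 \<le> signal_energy zs / D"
    proof -
      have "(cmod Z)\<^sup>2 * D \<le> (real (length zs) * signal_energy zs) * D"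
        unfolding Z_def by (intro mult_right_mono cmod_sum_list_le) auto
      also have "\<dots> = signal_energy zs * (real (length zs) * real D)"
        by simp
      also have "\<dots> \<le> signal_energy zs * (real (length zs + D))\<^sup>2"
        by (intro mult_left_mono signal_energy_nonneg) (simp add: power2_eq_square algebra_simps)
      finally show ?thesis
        using \<open>0 < D\<close> by (simp add: m power_divide divide_simps)
    qed
    finally show ?thesis by simp
  qed
  have "(\<Sum>xs\<in>permutations_of_set A.
        exp (Re (\<Sum>i<length (z # zs). (z # zs) ! i * a (xs ! i)))) =
      (\<Sum>x\<in>A. exp (Re (z * a x)) * (\<Sum>xs\<in>permutations_of_set (A - {x}).
        exp (Re (\<Sum>i<length zs. zs ! i * a (xs ! i)))))"
    unfolding sum_permutations_of_set_nonempty[OF Cons.prems(1) A]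
    by (simp add: sum.lessThan_Suc_shift exp_add sum_distrib_left
        del: sum.lessThan_Suc times_complex.sel)
  also have "\<dots> \<le> (\<Sum>x\<in>A. exp (Re (z * a x)) *
      (fact (m - 1) * exp (Re ((S - a x) / of_nat (m - 1) * Z) + K)))"
    by (intro sum_mono mult_left_mono IH) auto
  also have "\<dots> = (\<Sum>x\<in>A. fact (m - 1) *
      exp (Re (z * a x + (S - a x) / of_nat (m - 1) * Z) + K))"
    by (simp add: exp_add mult_ac del: times_complex.sel)
  also have "\<dots> = fact (m - 1) * exp (Re (c * (z + Z)) + K) * (\<Sum>x\<in>A. exp (Re (w * (a x - c))))"
    unfolding split
    by (simp add: exp_add mult_ac sum_distrib_left del: times_complex.sel)
  also have "\<dots> \<le> fact (m - 1) * exp (Re (c * (z + Z)) + K) *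
      (real m * exp ((cmod w)\<^sup>2 * \<mu>\<^sup>2 / 2))"
    unfolding c_def m_def S_def
    by (intro mult_left_mono uniform_mgf_le Cons.prems A) auto
  also have "\<dots> = fact m * exp (Re (c * (z + Z)) + (K + \<mu>\<^sup>2 * ((cmod w)\<^sup>2 / 2)))"
    by (simp add: fact_m exp_add mult_ac del: times_complex.sel)
  also have "\<dots> \<le> fact m * exp (Re (c * (z + Z)) +
      \<mu>\<^sup>2 * (1 + length (z # zs) / D) * signal_energy (z # zs))"
  proof -
    have "K + \<mu>\<^sup>2 * ((cmod w)\<^sup>2 / 2) \<le> K + \<mu>\<^sup>2 * ((cmod z)\<^sup>2 + signal_energy zs / D)"
      by (intro add_left_mono mult_left_mono w) auto
    also have "\<dots> = \<mu>\<^sup>2 * ((cmod z)\<^sup>2 + (1 + (length zs + 1) / D) * signal_energy zs)"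
      by (simp add: K_def add_divide_distrib algebra_simps)
    also have "\<dots> \<le> \<mu>\<^sup>2 * ((1 + (length zs + 1) / D) * ((cmod z)\<^sup>2 + signal_energy zs))"
      by (intro mult_left_mono) (auto simp: algebra_simps)
    finally show ?thesis
      by (simp add: mult.assoc add.commute del: times_complex.sel)
  qed
  finally show ?case
    by (simp add: c_def S_def Z_def m_def del: times_complex.sel)
qed


section \<open>Tail bounds for complex random variables\<close>

text \<open>
  A complex number of modulus above \<open>\<surd>2 T\<close> has a real or an imaginary part of absolute value at
  least \<open>T\<close>, so the tail is covered by four half-planes.
\<close>
lemma (in prob_space) complex_chernoff:
  fixes W :: "'a \<Rightarrow> complex"
  assumes [measurable]: "random_variable borel W" and "0 < s"
    and mgf: "\<And>u. cmod u = 1 \<Longrightarrow> (\<integral>\<^sup>+\<omega>. ennreal (exp (s * Re (u * W \<omega>))) \<partial>M) \<le> ennreal (exp b)"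
  shows "prob {\<omega> \<in> space M. sqrt 2 * T < cmod (W \<omega>)} \<le> 4 * exp (b - s * T)"
proof -
  define E where "E u = {\<omega> \<in> space M. Re (u * W \<omega>) \<ge> T}" for u
  have [measurable]: "E u \<in> events" for u
    unfolding E_def by measurable
  have E: "prob (E u) \<le> exp (b - s * T)" if "cmod u = 1" for u
  proof -
    have "emeasure M (E u) \<le> ennreal (exp (- s * T)) *
        (\<integral>\<^sup>+\<omega>\<in>space M. ennreal (exp (s * Re (u * W \<omega>))) \<partial>M)"
      unfolding E_def by (rule Chernoff_ineq_nn_integral_ge[OF \<open>0 < s\<close>]) auto
    also have "(\<integral>\<^sup>+\<omega>\<in>space M. ennreal (exp (s * Re (u * W \<omega>))) \<partial>M) =
        (\<integral>\<^sup>+\<omega>. ennreal (exp (s * Re (u * W \<omega>))) \<partial>M)"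
      by (intro nn_integral_cong) auto
    also have "ennreal (exp (- s * T)) * \<dots> \<le> ennreal (exp (- s * T)) * ennreal (exp b)"
      by (intro mult_left_mono mgf that) auto
    also have "\<dots> = ennreal (exp (b - s * T))"
      by (simp add: ennreal_mult[symmetric] exp_add[symmetric])
    finally show ?thesis
      by (simp add: emeasure_eq_measure)
  qed
  have sub: "{\<omega> \<in> space M. sqrt 2 * T < cmod (W \<omega>)} \<subseteq> (\<Union>u\<in>{1, -1, \<i>, -\<i>}. E u)"
  proof
    fix \<omega> assume \<omega>: "\<omega> \<in> {\<omega> \<in> space M. sqrt 2 * T < cmod (W \<omega>)}"
    have "T \<le> \<bar>Re (W \<omega>)\<bar> \<or> T \<le> \<bar>Im (W \<omega>)\<bar>"
    proof (rule ccontr)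
      assume "\<not> ?thesis"
      then have less: "\<bar>Re (W \<omega>)\<bar> < T" "\<bar>Im (W \<omega>)\<bar> < T"
        by auto
      then have "cmod (W \<omega>) \<le> sqrt (T\<^sup>2 + T\<^sup>2)"
        unfolding cmod_def
        by (intro real_sqrt_le_mono add_mono) (auto simp: abs_le_square_iff[symmetric])
      also have "\<dots> = sqrt 2 * T"
        using less by (simp add: real_sqrt_mult flip: mult_2)
      finally show False
        using \<omega> by simp
    qed
    then show "\<omega> \<in> (\<Union>u\<in>{1, -1, \<i>, -\<i>}. E u)"
      using \<omega> by (auto simp: E_def abs_real_def split: if_splits)
  qed
  have "prob {\<omega> \<in> space M. sqrt 2 * T < cmod (W \<omega>)} \<le> prob (\<Union>u\<in>{1, -1, \<i>, -\<i>}. E u)"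
    by (intro finite_measure_mono sub sets.finite_UN) auto
  also have "\<dots> \<le> (\<Sum>u\<in>{1, -1, \<i>, -\<i>}. prob (E u))"
    by (intro measure_UNION_le) auto
  also have "\<dots> \<le> (\<Sum>u\<in>{1::complex, -1, \<i>, -\<i>}. exp (b - s * T))"
    by (intro sum_mono E) auto
  also have "\<dots> = 4 * exp (b - s * T)"
    by (simp add: complex_eq_iff)
  finally show ?thesis .
qed

text \<open>
  The exponential rate \<open>s = \<surd>L / (\<mu> \<parallel>z\<parallel>)\<close> makes each term of the exponent at most linear in \<open>L\<close>: the mean
  contributes at most \<open>\<surd>L \<le> L\<close>, the fluctuation at most \<open>2 L\<close>, and the threshold \<open>- 10 L\<close>.
\<close>
lemma sampling_without_replacement_tail:
  fixes a :: "'p::finite \<Rightarrow> complex"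
  assumes bound: "\<And>x. cmod (a x) \<le> \<mu>" and "0 < \<mu>"
    and small: "2 * length zs \<le> CARD('p)" and "0 < signal_energy zs" and "1 \<le> L"
    and mean: "cmod ((\<Sum>x\<in>UNIV. a x) / of_nat CARD('p) * sum_list zs) \<le> \<mu> * sqrt (signal_energy zs)"
  shows "measure_pmf.prob (pmf_of_set (permutations_of_set UNIV))
      {xs. sqrt 2 * (10 * \<mu> * sqrt (signal_energy zs) * sqrt L) < cmod (\<Sum>i<length zs. zs ! i * a (xs ! i))}
    \<le> 4 * exp (- 7 * L)"
proof -
  define P :: "'p list set" where "P = permutations_of_set UNIV"
  define e where "e = sqrt (signal_energy zs)"
  define s where "s = sqrt L / (\<mu> * e)"
  define D where "D = CARD('p) - length zs"
  define c where "c = (\<Sum>x\<in>UNIV. a x) / of_nat CARD('p)"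
  have pos: "0 < e" "0 < s" "0 < sqrt L"
    using assms by (simp_all add: e_def s_def)
  have D: "CARD('p) = length zs + D" "0 < D" "length zs \<le> D"
    using small zero_less_card_finite[where ?'a = 'p] unfolding D_def by linarith+
  have "sqrt L \<le> L"
    using \<open>1 \<le> L\<close> by (simp add: real_le_lsqrt sqrt_le_D power2_eq_square)
  have s_scale: "s * (\<mu> * e) = sqrt L"
    using pos \<open>0 < \<mu>\<close> by (simp add: s_def)
  have mgf: "(\<integral>\<^sup>+xs. ennreal (exp (s * Re (u * (\<Sum>i<length zs. zs ! i * a (xs ! i))))) \<partial>pmf_of_set P)
      \<le> ennreal (exp (3 * L))" if u: "cmod u = 1" for u
  proof -
    \<comment> \<open>The rate and the direction are absorbed into the weights.\<close>
    define ys where "ys = map (\<lambda>z. of_real s * u * z) zs"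
    have len: "length ys = length zs"
      by (simp add: ys_def)
    have ys: "(\<Sum>i<length ys. ys ! i * a (xs ! i)) =
        of_real s * (u * (\<Sum>i<length zs. zs ! i * a (xs ! i)))" for xs
      by (simp add: ys_def sum_distrib_left mult.assoc)
    have sum_ys: "sum_list ys = of_real s * u * sum_list zs"
      by (simp add: ys_def sum_list_const_mult)
    have energy_ys: "signal_energy ys = s\<^sup>2 * e\<^sup>2"
      using u by (simp add: ys_def e_def signal_energy_def norm_mult power_mult_distrib
          sum_distrib_left sum_nonneg)
    have "(\<Sum>xs\<in>P. exp (s * Re (u * (\<Sum>i<length zs. zs ! i * a (xs ! i))))) =
        (\<Sum>xs\<in>P. exp (Re (\<Sum>i<length ys. ys ! i * a (xs ! i))))"
      unfolding ys by simp
    also have "\<dots> \<le> fact CARD('p) * exp (Re (c * sum_list ys) +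
        \<mu>\<^sup>2 * (1 + length ys / D) * signal_energy ys)"
      unfolding P_def c_def
      by (rule sampling_without_replacement_mgf_le) (use bound D len in auto)
    also have "\<dots> \<le> fact CARD('p) * exp (3 * L)"
    proof -
      have "Re (c * sum_list ys) \<le> cmod (c * sum_list ys)"
        by (rule complex_Re_le_cmod)
      also have "\<dots> = s * cmod (c * sum_list zs)"
        using u pos by (simp add: sum_ys norm_mult)
      also have "\<dots> \<le> s * (\<mu> * e)"
        using pos mean unfolding c_def e_def by (intro mult_left_mono) auto
      also have "\<dots> \<le> L"
        using s_scale \<open>sqrt L \<le> L\<close> by simp
      finally have mean_part: "Re (c * sum_list ys) \<le> L" .
      have "\<mu>\<^sup>2 * (1 + length ys / D) * signal_energy ys = (1 + length zs / D) * (s * (\<mu> * e))\<^sup>2"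
        unfolding len energy_ys by (simp add: power_mult_distrib)
      also have "\<dots> \<le> 2 * (s * (\<mu> * e))\<^sup>2"
        using D by (intro mult_right_mono) auto
      also have "\<dots> = 2 * L"
        unfolding s_scale using \<open>1 \<le> L\<close> by simp
      finally show ?thesis
        using mean_part by (simp del: times_complex.sel)
    qed
    finally have "(\<Sum>xs\<in>P. exp (s * Re (u * (\<Sum>i<length zs. zs ! i * a (xs ! i))))) / fact CARD('p)
        \<le> exp (3 * L)"
      by (simp add: divide_simps mult.commute)
    moreover have "(\<integral>\<^sup>+xs. ennreal (exp (s * Re (u * (\<Sum>i<length zs. zs ! i * a (xs ! i))))) \<partial>pmf_of_set P)
        = ennreal ((\<Sum>xs\<in>P. exp (s * Re (u * (\<Sum>i<length zs. zs ! i * a (xs ! i))))) / fact CARD('p))"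
      unfolding P_def
      by (subst nn_integral_pmf_of_set)
        (simp_all add: sum_nonneg divide_ennreal ennreal_of_nat_eq_real_of_nat del: times_complex.sel)
    ultimately show ?thesis
      by (simp del: times_complex.sel)
  qed
  have "measure_pmf.prob (pmf_of_set P)
      {xs \<in> space (pmf_of_set P). sqrt 2 * (10 * \<mu> * e * sqrt L) < cmod (\<Sum>i<length zs. zs ! i * a (xs ! i))}
    \<le> 4 * exp (3 * L - s * (10 * \<mu> * e * sqrt L))"
    by (rule prob_space.complex_chernoff[OF measure_pmf.prob_space_axioms _ pos(2) mgf]) simp_all
  also have "s * (10 * \<mu> * e * sqrt L) = 10 * (s * (\<mu> * e)) * sqrt L"
    by simp
  also have "3 * L - \<dots> = - 7 * L"
    unfolding s_scale using \<open>1 \<le> L\<close> by simp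
  finally show ?thesis
    by (simp add: P_def e_def)
qed


section \<open>Projections of complex Gaussian noise\<close>

text \<open>
  Completing the square: tilting a centred normal density by \<open>exp (\<alpha> x)\<close> gives the normal density
  with mean \<open>\<alpha> s\<^sup>2\<close>, up to a constant factor.
\<close>
lemma (in prob_space) centred_normal_mgf:
  assumes X: "distributed M lborel X (normal_density 0 s)" and s: "0 < s"
  shows "(\<integral>\<^sup>+\<omega>. ennreal (exp (\<alpha> * X \<omega>)) \<partial>M) = ennreal (exp (\<alpha>\<^sup>2 * s\<^sup>2 / 2))"
proof -
  have shift: "normal_density 0 s x * exp (\<alpha> * x) =
      exp (\<alpha>\<^sup>2 * s\<^sup>2 / 2) * normal_density (\<alpha> * s\<^sup>2) s x" for x
  proof -
    have "- x\<^sup>2 / (2 * s\<^sup>2) + \<alpha> * x = \<alpha>\<^sup>2 * s\<^sup>2 / 2 - (x - \<alpha> * s\<^sup>2)\<^sup>2 / (2 * s\<^sup>2)"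
      using s by (simp add: field_simps power2_eq_square)
    then show ?thesis
      by (simp add: normal_density_def exp_add[symmetric])
  qed
  have "(\<integral>\<^sup>+\<omega>. ennreal (exp (\<alpha> * X \<omega>)) \<partial>M) =
      (\<integral>\<^sup>+x. ennreal (normal_density 0 s x) * ennreal (exp (\<alpha> * x)) \<partial>lborel)"
    by (rule distributed_nn_integral[OF X, symmetric]) simp
  also have "\<dots> = (\<integral>\<^sup>+x. ennreal (exp (\<alpha>\<^sup>2 * s\<^sup>2 / 2)) * ennreal (normal_density (\<alpha> * s\<^sup>2) s x) \<partial>lborel)"
    by (simp add: ennreal_mult[symmetric] shift)
  also have "\<dots> = ennreal (exp (\<alpha>\<^sup>2 * s\<^sup>2 / 2)) * (\<integral>\<^sup>+x. ennreal (normal_density (\<alpha> * s\<^sup>2) s x) \<partial>lborel)"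
    by (rule nn_integral_cmult) simp
  also have "(\<integral>\<^sup>+x. ennreal (normal_density (\<alpha> * s\<^sup>2) s x) \<partial>lborel) = 1"
    using s by (subst nn_integral_eq_integral) auto
  finally show ?thesis
    by simp
qed

lemma (in prob_space) circular_gaussian_mgf:
  assumes w: "circular_gaussian M \<sigma> w" and \<sigma>: "0 < \<sigma>"
  shows "(\<integral>\<^sup>+\<omega>. ennreal (exp (Re (c * w \<omega>))) \<partial>M) = ennreal (exp ((cmod c)\<^sup>2 * \<sigma>\<^sup>2 / 4))"
proof -
  define X where "X = case_bool (\<lambda>\<omega>. Re (w \<omega>)) (\<lambda>\<omega>. Im (w \<omega>))"
  define \<alpha> where "\<alpha> = case_bool (Re c) (- Im c)"
  have X: "distributed M lborel (X b) (normal_density 0 (\<sigma> / sqrt 2))" for b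
    using w by (simp add: circular_gaussian_def X_def split: bool.split)
  have "case_bool borel borel = (\<lambda>_. borel :: real measure)"
    by (simp add: fun_eq_iff split: bool.split)
  then have "indep_vars (\<lambda>_. borel) X UNIV"
    using w by (simp add: circular_gaussian_def indep_var_def X_def)
  then have "indep_vars (\<lambda>_. borel) (\<lambda>b \<omega>. ennreal (exp (\<alpha> b * X b \<omega>))) UNIV"
    by (rule indep_vars_compose2) simp
  note prod = indep_vars_nn_integral[OF _ this]
  have "(\<integral>\<^sup>+\<omega>. ennreal (exp (Re (c * w \<omega>))) \<partial>M) =
      (\<integral>\<^sup>+\<omega>. (\<Prod>b\<in>UNIV. ennreal (exp (\<alpha> b * X b \<omega>))) \<partial>M)"
    by (simp add: UNIV_bool X_def \<alpha>_def ennreal_mult[symmetric] exp_add[symmetric] algebra_simps)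
  also have "\<dots> = (\<Prod>b\<in>UNIV. ennreal (exp ((\<alpha> b)\<^sup>2 * (\<sigma> / sqrt 2)\<^sup>2 / 2)))"
    by (subst prod) (use \<sigma> in \<open>simp_all add: centred_normal_mgf[OF X]\<close>)
  also have "\<dots> = ennreal (exp ((cmod c)\<^sup>2 * \<sigma>\<^sup>2 / 4))"
    by (simp add: UNIV_bool \<alpha>_def ennreal_mult[symmetric] exp_add[symmetric] cmod_power2
        power_divide field_simps)
  finally show ?thesis .
qed

lemma (in prob_space) circular_gaussian_vector_mgf:
  fixes \<eta> :: "'a \<Rightarrow> complex ^ 'n::finite" and c :: "'n \<Rightarrow> complex"
  assumes \<eta>: "circular_gaussian_vector M \<sigma> \<eta>" and \<sigma>: "0 < \<sigma>"
  shows "(\<integral>\<^sup>+\<omega>. ennreal (exp (Re (\<Sum>i\<in>UNIV. c i * \<eta> \<omega> $ i))) \<partial>M) =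
    ennreal (exp ((\<Sum>i\<in>UNIV. (cmod (c i))\<^sup>2) * \<sigma>\<^sup>2 / 4))"
proof -
  have "indep_vars (\<lambda>_. borel) (\<lambda>i \<omega>. ennreal (exp (Re (c i * \<eta> \<omega> $ i)))) UNIV"
    by (rule indep_vars_compose2[where Y = "\<lambda>i x. ennreal (exp (Re (c i * x)))"])
      (use \<eta> in \<open>auto simp: circular_gaussian_vector_def\<close>)
  note prod = indep_vars_nn_integral[OF _ this]
  have "(\<integral>\<^sup>+\<omega>. ennreal (exp (Re (\<Sum>i\<in>UNIV. c i * \<eta> \<omega> $ i))) \<partial>M) =
      (\<integral>\<^sup>+\<omega>. (\<Prod>i\<in>UNIV. ennreal (exp (Re (c i * \<eta> \<omega> $ i)))) \<partial>M)"
    by (simp add: prod_ennreal exp_sum del: times_complex.sel)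
  also have "\<dots> = (\<Prod>i\<in>UNIV. ennreal (exp ((cmod (c i))\<^sup>2 * \<sigma>\<^sup>2 / 4)))"
  proof (subst prod)
    have "circular_gaussian M \<sigma> (\<lambda>\<omega>. \<eta> \<omega> $ i)" for i
      using \<eta> by (simp add: circular_gaussian_vector_def)
    then show "(\<Prod>i\<in>UNIV. \<integral>\<^sup>+\<omega>. ennreal (exp (Re (c i * \<eta> \<omega> $ i))) \<partial>M) =
        (\<Prod>i\<in>UNIV. ennreal (exp ((cmod (c i))\<^sup>2 * \<sigma>\<^sup>2 / 4)))"
      by (intro prod.cong refl circular_gaussian_mgf \<sigma>)
  qed auto
  also have "\<dots> = ennreal (exp ((\<Sum>i\<in>UNIV. (cmod (c i))\<^sup>2) * \<sigma>\<^sup>2 / 4))"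
    by (simp add: prod_ennreal exp_sum[symmetric] sum_distrib_right sum_divide_distrib)
  finally show ?thesis .
qed

text \<open>
  Projecting on a unit vector leaves the variance \<open>\<sigma>\<^sup>2\<close>. The rate \<open>s\<close> minimises the exponent
  \<open>s\<^sup>2 \<sigma>\<^sup>2 / 4 - s \<sigma> \<surd>(2 L)\<close>.
\<close>
lemma (in prob_space) noise_tail:
  fixes \<eta> :: "'a \<Rightarrow> complex ^ 'n::finite"
  assumes \<eta>: "circular_gaussian_vector M \<sigma> \<eta>" and "0 < \<sigma>" and "norm u = 1" and "0 < L"
  shows "(\<lambda>\<omega>. cinner u (\<eta> \<omega>)) \<in> borel_measurable M"
    and "prob {\<omega> \<in> space M. sqrt 2 * (\<sigma> * sqrt (2 * L)) < cmod (cinner u (\<eta> \<omega>))} \<le> 4 * exp (- 2 * L)"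
proof -
  have [measurable]: "(\<lambda>\<omega>. \<eta> \<omega> $ r) \<in> borel_measurable M" for r
    using \<eta> by (auto simp: circular_gaussian_vector_def indep_vars_def)
  show meas: "(\<lambda>\<omega>. cinner u (\<eta> \<omega>)) \<in> borel_measurable M"
    unfolding cinner_def by measurable
  define s where "s = 2 * sqrt (2 * L) / \<sigma>"
  have "0 < s"
    using assms by (simp add: s_def)
  have unit: "(\<Sum>r\<in>UNIV. (cmod (u $ r))\<^sup>2) = 1"
    using \<open>norm u = 1\<close> by (simp add: norm_vec_def L2_set_def)
  have "(\<integral>\<^sup>+\<omega>. ennreal (exp (s * Re (v * cinner u (\<eta> \<omega>)))) \<partial>M) \<le> ennreal (exp (2 * L))"
    if v: "cmod v = 1" for v
  proof -
    define c where "c r = of_real s * v * cnj (u $ r)" for r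
    have "s * Re (v * cinner u (\<eta> \<omega>)) = Re (\<Sum>r\<in>UNIV. c r * \<eta> \<omega> $ r)" for \<omega>
    proof -
      have "(\<Sum>r\<in>UNIV. c r * \<eta> \<omega> $ r) = of_real s * (v * cinner u (\<eta> \<omega>))"
        by (simp add: c_def cinner_def sum_distrib_left mult.assoc)
      then show ?thesis
        by simp
    qed
    then have "(\<integral>\<^sup>+\<omega>. ennreal (exp (s * Re (v * cinner u (\<eta> \<omega>)))) \<partial>M) =
        ennreal (exp ((\<Sum>r\<in>UNIV. (cmod (c r))\<^sup>2) * \<sigma>\<^sup>2 / 4))"
      using circular_gaussian_vector_mgf[OF \<eta> \<open>0 < \<sigma>\<close>, of c] by simp
    also have "(\<Sum>r\<in>UNIV. (cmod (c r))\<^sup>2) = s\<^sup>2"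
      using v unit by (simp add: c_def norm_mult power_mult_distrib flip: sum_distrib_left)
    also have "s\<^sup>2 * \<sigma>\<^sup>2 / 4 = 2 * L"
      using assms by (simp add: s_def power_divide power_mult_distrib)
    finally show ?thesis by simp
  qed
  note complex_chernoff[OF meas \<open>0 < s\<close> this, of "\<sigma> * sqrt (2 * L)"]
  also have "s * (\<sigma> * sqrt (2 * L)) = 2 * (sqrt (2 * L) * sqrt (2 * L))"
    using \<open>0 < \<sigma>\<close> by (simp add: s_def)
  also have "2 * L - \<dots> = - 2 * L"
    using \<open>0 < L\<close> by simp
  finally show "prob {\<omega> \<in> space M. sqrt 2 * (\<sigma> * sqrt (2 * L)) < cmod (cinner u (\<eta> \<omega>))}
      \<le> 4 * exp (- 2 * L)" .
qed

lemma (in prob_space) normal_second_moment: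
  assumes X: "distributed M lborel X (normal_density 0 s)" and s: "0 < s"
  shows "integrable M (\<lambda>\<omega>. (X \<omega>)\<^sup>2)" and "expectation (\<lambda>\<omega>. (X \<omega>)\<^sup>2) = s\<^sup>2"
proof -
  note moment = normal_moment_even[OF s, of 0 1]
  have "integrable lborel (\<lambda>x. normal_density 0 s x * x\<^sup>2)"
    using integrable.intros[OF moment] by simp
  then show "integrable M (\<lambda>\<omega>. (X \<omega>)\<^sup>2)"
    using distributed_integrable[OF X, of "\<lambda>x. x\<^sup>2"] by simp
  have "expectation (\<lambda>\<omega>. (X \<omega>)\<^sup>2) = (\<integral>x. normal_density 0 s x * x\<^sup>2 \<partial>lborel)"
    by (rule distributed_integral[OF X, symmetric]) auto
  also have "\<dots> = s\<^sup>2"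
    using has_bochner_integral_integral_eq[OF moment] by simp
  finally show "expectation (\<lambda>\<omega>. (X \<omega>)\<^sup>2) = s\<^sup>2" .
qed

lemma (in prob_space) circular_gaussian_vector_energy:
  fixes \<eta> :: "'a \<Rightarrow> complex ^ 'n::finite"
  assumes \<eta>: "circular_gaussian_vector M \<sigma> \<eta>" and \<sigma>: "0 < \<sigma>"
  shows "expectation (\<lambda>\<omega>. (norm (\<eta> \<omega>))\<^sup>2) = real CARD('n) * \<sigma>\<^sup>2"
proof -
  have Re: "distributed M lborel (\<lambda>\<omega>. Re (\<eta> \<omega> $ i)) (normal_density 0 (\<sigma> / sqrt 2))"
    and Im: "distributed M lborel (\<lambda>\<omega>. Im (\<eta> \<omega> $ i)) (normal_density 0 (\<sigma> / sqrt 2))" for i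
    using \<eta> by (simp_all add: circular_gaussian_vector_def circular_gaussian_def)
  have pos: "0 < \<sigma> / sqrt 2"
    using \<sigma> by simp
  have "(norm v)\<^sup>2 = (\<Sum>i\<in>UNIV. (Re (v $ i))\<^sup>2 + (Im (v $ i))\<^sup>2)" for v :: "complex ^ 'n"
    by (simp add: norm_vec_def L2_set_def sum_nonneg cmod_power2)
  then have "expectation (\<lambda>\<omega>. (norm (\<eta> \<omega>))\<^sup>2) =
      (\<Sum>i\<in>UNIV. expectation (\<lambda>\<omega>. (Re (\<eta> \<omega> $ i))\<^sup>2) + expectation (\<lambda>\<omega>. (Im (\<eta> \<omega> $ i))\<^sup>2))"
    by (simp add: Bochner_Integration.integral_sum Bochner_Integration.integral_add
        normal_second_moment(1)[OF Re pos] normal_second_moment(1)[OF Im pos])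
  also have "\<dots> = real CARD('n) * \<sigma>\<^sup>2"
    by (simp add: normal_second_moment(2)[OF Re pos] normal_second_moment(2)[OF Im pos] power_divide)
  finally show ?thesis .
qed


section \<open>Interference between columns\<close>

lemma worst_case_coherence_ge:
  fixes X :: "complex ^ 'p::finite ^ 'n"
  assumes "i \<noteq> j"
  shows "cmod (cinner (column i X) (column j X)) \<le> worst_case_coherence X"
proof -
  have "{cmod (cinner (column i X) (column j X)) | i j. i \<noteq> j} \<subseteq>
      (\<lambda>(i, j). cmod (cinner (column i X) (column j X))) ` UNIV"
    by auto
  then have "finite {cmod (cinner (column i X) (column j X)) | i j. i \<noteq> j}"
    by (rule finite_subset) simp
  then show ?thesis
    unfolding worst_case_coherence_def using \<open>i \<noteq> j\<close> by (intro Max_ge) auto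
qed

definition interference :: "complex ^ 'p ^ 'n \<Rightarrow> 'p \<Rightarrow> complex ^ 'p \<Rightarrow> complex" where
  "interference X i \<beta> = (\<Sum>j\<in>UNIV - {i}. cinner (column i X) (column j X) * \<beta> $ j)"

text \<open>
  The sum over columns becomes a sum over the positions of the nonzero entries. The population takes
  the value 0 at \<open>i\<close> itself, so that it is indexed by all columns and the draws are uniform on it.
\<close>
lemma interference_sparse_signal:
  fixes X :: "complex ^ 'p::finite ^ 'n"
  shows "interference X i (sparse_signal z \<pi>) =
    (\<Sum>l<length z. z ! l * (if \<pi> ! l = i then 0 else cinner (column i X) (column (\<pi> ! l) X)))"
proof -
  define a where "a j = (if j = i then 0 else cinner (column i X) (column j X))" for j
  have "interference X i (sparse_signal z \<pi>) = (\<Sum>j\<in>UNIV. a j * sparse_signal z \<pi> $ j)"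
    unfolding interference_def a_def by (rule sum.mono_neutral_cong_left) auto
  also have "\<dots> = (\<Sum>j\<in>UNIV. \<Sum>l | l \<in> {..<length z} \<and> \<pi> ! l = j. z ! l * a (\<pi> ! l))"
    by (simp add: sparse_signal_def sum_distrib_left mult.commute)
  also have "\<dots> = (\<Sum>l<length z. z ! l * a (\<pi> ! l))"
    by (rule sum.group) auto
  finally show ?thesis
    by (simp add: a_def)
qed

text \<open>
  The average coherence bounds the population mean by \<open>\<mu> / \<surd>n\<close>, and Cauchy-Schwarz bounds the sum
  of the at most \<open>n\<close> weights by \<open>\<surd>n \<parallel>z\<parallel>\<close>, so the mean of the interference is at most \<open>\<mu> \<parallel>z\<parallel>\<close>.
\<close>
lemma interference_tail:
  fixes X :: "complex ^ 'p::finite ^ 'n::finite"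
  assumes average: "average_coherence X \<le> worst_case_coherence X / sqrt (real CARD('n))"
    and "2 \<le> CARD('p)" and "length z \<le> CARD('n)" and "2 * length z \<le> CARD('p)"
    and "0 < signal_energy z" and "1 \<le> L"
  shows "measure_pmf.prob (pmf_of_set (permutations_of_set UNIV))
      {\<pi>. sqrt 2 * (10 * worst_case_coherence X * sqrt (signal_energy z) * sqrt L)
          < cmod (interference X i (sparse_signal z \<pi>))} \<le> 4 * exp (- 7 * L)"
proof -
  define \<mu> where "\<mu> = worst_case_coherence X"
  define a where "a j = (if j = i then 0 else cinner (column i X) (column j X))" for j
  have interference: "interference X i (sparse_signal z \<pi>) = (\<Sum>l<length z. z ! l * a (\<pi> ! l))" for \<pi>
    by (simp add: interference_sparse_signal a_def)
  obtain i' where "i' \<noteq> i"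
    using \<open>2 \<le> CARD('p)\<close> by (metis UNIV_I card_le_Suc0_iff_eq finite not_less_eq_eq numeral_2_eq_2)
  then have "0 \<le> \<mu>"
    using worst_case_coherence_ge[of i' i X] order_trans[OF norm_ge_zero] unfolding \<mu>_def by blast
  have bound: "cmod (a j) \<le> \<mu>" for j
    using worst_case_coherence_ge[of i j X] \<open>0 \<le> \<mu>\<close> by (auto simp: a_def \<mu>_def)
  show ?thesis
  proof (cases "\<mu> = 0")
    case True
    \<comment> \<open>Orthogonal columns: there is no interference, while the rate \<open>\<surd>L / (\<mu> \<parallel>z\<parallel>)\<close> is undefined.\<close>
    then have "a j = 0" for j
      using bound[of j] by simp
    then show ?thesis
      using True by (simp add: interference \<mu>_def)
  next
    case False
    then have "0 < \<mu>"
      using \<open>0 \<le> \<mu>\<close> by simp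
    have n: "0 < real CARD('n)" and p: "1 < real CARD('p)"
      using \<open>2 \<le> CARD('p)\<close> by simp_all
    have "(\<Sum>j\<in>UNIV. a j) = (\<Sum>j\<in>UNIV - {i}. cinner (column i X) (column j X))"
      unfolding a_def by (rule sum.mono_neutral_cong_right) auto
    then have "cmod (\<Sum>j\<in>UNIV. a j) \<le>
        Max (range (\<lambda>i. cmod (\<Sum>j\<in>UNIV - {i}. cinner (column i X) (column j X))))"
      by (intro Max_ge) auto
    also have "\<dots> = (real CARD('p) - 1) * average_coherence X"
      using p by (simp add: average_coherence_def)
    also have "\<dots> \<le> (real CARD('p) - 1) * (\<mu> / sqrt (real CARD('n)))"
      using p average unfolding \<mu>_def by (intro mult_left_mono) auto
    also have "\<dots> \<le> real CARD('p) * (\<mu> / sqrt (real CARD('n)))"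
      using \<open>0 < \<mu>\<close> by (intro mult_right_mono) auto
    finally have sum_a: "cmod (\<Sum>j\<in>UNIV. a j) / real CARD('p) \<le> \<mu> / sqrt (real CARD('n))"
      using p by (simp add: divide_simps mult.commute)
    have sum_z: "cmod (sum_list z) \<le> sqrt (real CARD('n)) * sqrt (signal_energy z)"
    proof -
      have "(cmod (sum_list z))\<^sup>2 \<le> real (length z) * signal_energy z"
        by (rule cmod_sum_list_le)
      also have "\<dots> \<le> real CARD('n) * signal_energy z"
        using assms by (intro mult_right_mono) auto
      finally show ?thesis
        by (simp add: real_le_rsqrt flip: real_sqrt_mult)
    qed
    have "cmod ((\<Sum>j\<in>UNIV. a j) / of_nat CARD('p) * sum_list z) =
        cmod (\<Sum>j\<in>UNIV. a j) / real CARD('p) * cmod (sum_list z)"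
      by (simp add: norm_mult norm_divide)
    also have "\<dots> \<le> \<mu> / sqrt (real CARD('n)) * (sqrt (real CARD('n)) * sqrt (signal_energy z))"
      using \<open>0 < \<mu>\<close> by (intro mult_mono sum_a sum_z) auto
    also have "\<dots> = \<mu> * sqrt (signal_energy z)"
      using n by simp
    finally show ?thesis
      unfolding interference \<mu>_def[symmetric]
      by (intro sampling_without_replacement_tail bound \<open>0 < \<mu>\<close>) (use assms in auto)
  qed
qed


section \<open>Recovery by one-step thresholding\<close>

lemma matched_filter_eq:
  fixes X :: "complex ^ 'p::finite ^ 'n::finite"
  assumes "norm (column i X) = 1"
  shows "(hermitian_transpose X *v (X *v \<beta> + \<eta>)) $ i =
    \<beta> $ i + interference X i \<beta> + cinner (column i X) \<eta>"
proof -
  have "(\<Sum>r\<in>UNIV. (cmod (X $ r $ i))\<^sup>2) = 1"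
    using assms by (simp add: norm_vec_def L2_set_def column_def)
  then have unit: "cinner (column i X) (column i X) = 1"
    by (simp add: cinner_def column_def mult.commute complex_norm_square[symmetric]
        flip: of_real_power of_real_sum)
  have "(hermitian_transpose X *v (X *v \<beta> + \<eta>)) $ i = cinner (column i X) (X *v \<beta> + \<eta>)"
    by (simp add: hermitian_transpose_def matrix_vector_mult_def cinner_def column_def)
  also have "\<dots> = cinner (column i X) (X *v \<beta>) + cinner (column i X) \<eta>"
    by (simp add: cinner_def distrib_left sum.distrib)
  also have "cinner (column i X) (X *v \<beta>) =
      (\<Sum>j\<in>UNIV. cinner (column i X) (column j X) * \<beta> $ j)"
    unfolding cinner_def matrix_vector_mult_def column_def
    by (simp add: sum_distrib_left sum_distrib_right mult.assoc) (rule sum.swap)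
  also have "\<dots> = \<beta> $ i + interference X i \<beta>"
    unfolding interference_def by (simp add: sum.remove[of UNIV i] unit)
  finally show ?thesis .
qed

lemma OST_eq_true_model:
  fixes X :: "complex ^ 'p::finite ^ 'n::finite"
  assumes unit: "\<And>i. norm (column i X) = 1"
    and interference: "\<And>i. cmod (interference X i \<beta>) \<le> A"
    and noise: "\<And>i. cmod (cinner (column i X) \<eta>) \<le> B"
    and "A + B \<le> lam" and signal: "\<And>i. i \<in> true_model \<beta> \<Longrightarrow> 2 * lam < cmod (\<beta> $ i)"
  shows "OST X (X *v \<beta> + \<eta>) lam = true_model \<beta>"
proof -
  have "lam < cmod (\<beta> $ i + interference X i \<beta> + cinner (column i X) \<eta>) \<longleftrightarrow> i \<in> true_model \<beta>" for i
  proof -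
    define e where "e = interference X i \<beta> + cinner (column i X) \<eta>"
    have e: "cmod e \<le> lam"
      using interference[of i] noise[of i] \<open>A + B \<le> lam\<close>
        norm_triangle_ineq[of "interference X i \<beta>" "cinner (column i X) \<eta>"]
      by (simp add: e_def)
    have "lam < cmod (\<beta> $ i + e) \<longleftrightarrow> i \<in> true_model \<beta>"
    proof
      assume "i \<in> true_model \<beta>"
      then show "lam < cmod (\<beta> $ i + e)"
        using signal[of i] e norm_diff_ineq[of "\<beta> $ i" e] by simp
    next
      assume "lam < cmod (\<beta> $ i + e)"
      then have "\<beta> $ i \<noteq> 0"
        using e by auto
      then show "i \<in> true_model \<beta>"
        by (simp add: true_model_def)
    qed
    then show ?thesis
      by (simp add: e_def add.assoc)
  qed
  then show ?thesis
    by (auto simp: OST_def matched_filter_eq[OF unit])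
qed

text \<open>
  The two terms of the threshold are the interference level and the noise level, divided by \<open>t\<close> and
  \<open>1 - t\<close>.
\<close>
lemma OST_threshold_eq:
  assumes "0 < n" "0 < \<sigma>" "1 \<le> p"
  shows "OST_threshold t mu n p (SNR z (real n * \<sigma>\<^sup>2)) \<sigma> =
    max (sqrt 2 * (10 * mu * sqrt (signal_energy z) * sqrt (ln (real p))) / t)
      (sqrt 2 * (\<sigma> * sqrt (2 * ln (real p))) / (1 - t))"
proof -
  have "sqrt (real n * SNR z (real n * \<sigma>\<^sup>2)) = sqrt (signal_energy z) / \<sigma>"
    using assms by (simp add: SNR_def real_sqrt_divide)
  moreover have "sqrt (2 * \<sigma>\<^sup>2 * ln (real p)) = sqrt 2 * \<sigma> * sqrt (ln (real p))"
    using assms by (simp add: real_sqrt_mult)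
  moreover have "0 \<le> sqrt 2 * \<sigma> * sqrt (ln (real p))"
    using assms by simp
  ultimately show ?thesis
    using \<open>0 < \<sigma>\<close> unfolding OST_threshold_def
    by (simp only: max_mult_distrib_right if_True) (simp add: real_sqrt_mult mult_ac)
qed

lemma SNR_mult_MAR:
  assumes "0 < signal_energy z"
  shows "SNR z N * MAR z = SNR_min z N"
  using assms by (simp add: SNR_def MAR_def SNR_min_def)

lemma Max_triple_less_iff: "Max {a, b, c} < x \<longleftrightarrow> a < x \<and> b < x \<and> c < x" for a b c x :: real
  by simp

text \<open>
  \<open>SNR_min\<close> is proportional to \<open>k / n\<close>, so both \<open>n\<close> and \<open>k\<close> cancel from the hypothesis on \<open>n\<close>. What
  remains is the square of the claim.
\<close>
lemma noise_level_lt_signal_min: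
  assumes "0 < k" "0 < n" "0 < \<sigma>" "t < 1" "0 < signal_min z" "length z = k" "0 \<le> L"
    and "8 / (1 - t)\<^sup>2 / SNR_min z (real n * \<sigma>\<^sup>2) * (2 * real k * L) < real n"
  shows "2 * (sqrt 2 * (\<sigma> * sqrt (2 * L)) / (1 - t)) < signal_min z"
proof -
  define m where "m = signal_min z"
  have "8 / (1 - t)\<^sup>2 / SNR_min z (real n * \<sigma>\<^sup>2) * (2 * real k * L) =
      real n * (16 * \<sigma>\<^sup>2 * L / ((1 - t)\<^sup>2 * m\<^sup>2))"
    using assms by (simp add: SNR_min_def m_def)
  then have "real n * (16 * \<sigma>\<^sup>2 * L / ((1 - t)\<^sup>2 * m\<^sup>2)) < real n * 1"
    using assms(8) by simp
  then have "16 * \<sigma>\<^sup>2 * L / ((1 - t)\<^sup>2 * m\<^sup>2) < 1"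
    using \<open>0 < n\<close> by (subst (asm) mult_less_cancel_left_pos) auto
  then have "16 * \<sigma>\<^sup>2 * L / (1 - t)\<^sup>2 < m\<^sup>2"
    using assms by (simp add: divide_simps m_def mult.commute)
  also have "16 * \<sigma>\<^sup>2 * L / (1 - t)\<^sup>2 = (2 * (sqrt 2 * (\<sigma> * sqrt (2 * L)) / (1 - t)))\<^sup>2"
    using \<open>0 \<le> L\<close> by (simp add: power_divide power_mult_distrib)
  finally show ?thesis
    unfolding m_def[symmetric] by (rule power2_less_imp_less) (use assms in \<open>simp add: m_def\<close>)
qed

text \<open>
  For \<open>\<gamma> \<noteq> 0\<close>, raising the hypothesis on \<open>n\<close> to the power \<open>2 / \<gamma>\<close> and using
  \<open>\<mu>\<^sup>2 = c\<^sub>1\<^sup>2 n\<^bsup>-2/\<gamma>\<^esup>\<close> gives the square of the claim.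
\<close>
lemma interference_level_lt_signal_min:
  assumes "0 < k" "0 < n" "0 < t" "0 < signal_min z" "0 < signal_energy z" "length z = k" "0 \<le> L"
    and \<gamma>: "\<gamma> = 0 \<or> 2 \<le> \<gamma>"
    and \<mu>: "\<mu> = c1 * (if \<gamma> = 0 then 0 else real n powr (- 1 / \<gamma>))"
    and n: "((20 * c1)\<^sup>2 / t\<^sup>2 / MAR z * (2 * real k * L)) powr (\<gamma> / 2) < real n"
  shows "2 * (sqrt 2 * (10 * \<mu> * sqrt (signal_energy z) * sqrt L) / t) < signal_min z"
proof (cases "\<gamma> = 0")
  case True
  then show ?thesis
    using assms by simp
next
  case False
  then have "0 < \<gamma>"
    using \<gamma> by linarith
  define m where "m = signal_min z"
  define Q where "Q = (20 * c1)\<^sup>2 / t\<^sup>2 / MAR z * (2 * real k * L)"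
  have Q: "Q = 800 * c1\<^sup>2 * signal_energy z * L / (t\<^sup>2 * m\<^sup>2)"
    using assms by (simp add: Q_def MAR_def m_def power_mult_distrib)
  have "0 \<le> Q"
    using assms unfolding Q by simp
  have "Q = (Q powr (\<gamma> / 2)) powr (2 / \<gamma>)"
    using \<open>0 < \<gamma>\<close> \<open>0 \<le> Q\<close> by (simp add: powr_powr)
  also have "\<dots> < real n powr (2 / \<gamma>)"
    using n \<open>0 < \<gamma>\<close> by (intro powr_less_mono2) (auto simp: Q_def)
  finally have "real n powr (- 2 / \<gamma>) * Q < real n powr (- 2 / \<gamma>) * real n powr (2 / \<gamma>)"
    using \<open>0 < n\<close> by (intro mult_strict_left_mono) auto
  also have "\<dots> = 1"
    using \<open>0 < n\<close> by (simp flip: powr_add)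
  finally have "real n powr (- 2 / \<gamma>) * Q < 1" .
  moreover have "\<mu>\<^sup>2 = c1\<^sup>2 * real n powr (- 2 / \<gamma>)"
    using False \<open>0 < n\<close> by (simp add: \<mu> power_mult_distrib powr_power)
  ultimately have "800 * \<mu>\<^sup>2 * signal_energy z * L / (t\<^sup>2 * m\<^sup>2) < 1"
    by (simp add: Q mult_ac)
  then have "800 * \<mu>\<^sup>2 * signal_energy z * L / t\<^sup>2 < m\<^sup>2"
    using assms by (simp add: divide_simps m_def mult.commute)
  also have "800 * \<mu>\<^sup>2 * signal_energy z * L / t\<^sup>2 =
      (2 * (sqrt 2 * (10 * \<mu> * sqrt (signal_energy z) * sqrt L) / t))\<^sup>2"
    using assms by (simp add: power_divide power_mult_distrib)
  finally show ?thesis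
    unfolding m_def[symmetric] by (rule power2_less_imp_less) (use assms in \<open>simp add: m_def\<close>)
qed


section \<open>Probability of exact recovery\<close>

text \<open>
  The covering is required almost everywhere: a random list with the law of a uniformly random
  permutation may fail to be a permutation on a null set.
\<close>
lemma (in prob_space) prob_le_union_bound:
  fixes B C :: "'i::finite \<Rightarrow> 'a set"
  assumes "\<And>i. B i \<in> events" "\<And>i. C i \<in> events" and "AE \<omega> in M. \<omega> \<in> A \<longrightarrow> \<omega> \<in> (\<Union>i. B i) \<union> (\<Union>i. C i)"
    and "\<And>i. prob (B i) \<le> b" "\<And>i. prob (C i) \<le> c"
  shows "prob A \<le> real CARD('i) * (b + c)"
proof -
  have "prob A \<le> prob ((\<Union>i. B i) \<union> (\<Union>i. C i))"
    using assms by (intro finite_measure_mono_AE) auto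
  also have "\<dots> \<le> prob (\<Union>i. B i) + prob (\<Union>i. C i)"
    using assms by (intro measure_Un_le sets.finite_UN) auto
  also have "\<dots> \<le> (\<Sum>i\<in>UNIV. prob (B i)) + (\<Sum>i\<in>UNIV. prob (C i))"
    using assms by (intro add_mono measure_UNION_le) auto
  also have "\<dots> \<le> (\<Sum>i\<in>(UNIV :: 'i set). b) + (\<Sum>i\<in>(UNIV :: 'i set). c)"
    using assms by (intro add_mono sum_mono) auto
  finally show ?thesis
    by (simp add: distrib_left)
qed

theorem theorem1:
  fixes M :: "'a measure"
    and X :: "complex ^ 'p::finite ^ 'n::finite"
    and k :: nat
    and z :: "complex list"
    and \<pi> :: "'a \<Rightarrow> 'p list"
    and \<eta> :: "'a \<Rightarrow> complex ^ 'n"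
    and \<sigma> t c1 c2 \<gamma> N lam :: real
  assumes "prob_space M"
    and "0 < k" and "k < CARD('n)" and "CARD('n) \<le> CARD('p)"
    and unit_columns: "\<And>j. norm (column j X) = 1"
    and coherence: "coherence_property X"
    and z: "length z = k" "0 \<notin> set z"
    and uniform_permutation:
      "distr M (count_space UNIV) \<pi> = measure_pmf (pmf_of_set (permutations_of_set UNIV))"
    and "0 < \<sigma>"
    and noise: "circular_gaussian_vector M \<sigma> \<eta>"
    and indep: "independent_pair M (count_space UNIV) \<pi> borel \<eta>"
    and N_def: "N = (LINT \<omega>|M. (norm (\<eta> \<omega>))\<^sup>2)"
    and "0 < t" and "t < 1"
    and lam_def:
      "lam = OST_threshold t (worst_case_coherence X) CARD('n) CARD('p) (SNR z N) \<sigma>"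
    and "0 < c1" and "\<gamma> = 0 \<or> 2 \<le> \<gamma>"
    and coherence_scaling:
      "worst_case_coherence X = c1 * (if \<gamma> = 0 then 0 else real CARD('n) powr (- 1 / \<gamma>))"
    and c2_def: "c2 = (20 * c1)\<^sup>2"
    and "CARD('p) \<ge> 128"
  shows "(real CARD('n) > measurement_bound t c2 \<gamma> k CARD('p) (SNR_min z N) (MAR z) \<longleftrightarrow>
          real CARD('n) > measurement_bound t c2 \<gamma> k CARD('p) (SNR z N * MAR z) (MAR z)) \<and>
         (real CARD('n) > measurement_bound t c2 \<gamma> k CARD('p) (SNR_min z N) (MAR z) \<longrightarrow>
          measure M {\<omega> \<in> space M.
            OST X (X *v sparse_signal z (\<pi> \<omega>) + \<eta> \<omega>) lam
              \<noteq> true_model (sparse_signal z (\<pi> \<omega>))} \<le> 6 / real CARD('p))"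
proof (intro conjI impI)
  interpret prob_space M by fact
  define L where "L = ln (real CARD('p))"
  have z_nonempty: "z \<noteq> []"
    using z \<open>0 < k\<close> by auto
  note min_pos = signal_min_pos[OF z_nonempty z(2)]
    and energy_pos = signal_energy_pos[OF z_nonempty z(2)]
  have N: "N = real CARD('n) * \<sigma>\<^sup>2"
    unfolding N_def by (rule circular_gaussian_vector_energy[OF noise \<open>0 < \<sigma>\<close>])
  have exp_L: "exp L = real CARD('p)"
    by (simp add: L_def)
  have "1 \<le> L"
    unfolding L_def using \<open>CARD('p) \<ge> 128\<close> exp_le by (subst ln_ge_iff) auto
  show "real CARD('n) > measurement_bound t c2 \<gamma> k CARD('p) (SNR_min z N) (MAR z) \<longleftrightarrow>
      real CARD('n) > measurement_bound t c2 \<gamma> k CARD('p) (SNR z N * MAR z) (MAR z)"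
    by (simp only: SNR_mult_MAR[OF energy_pos])
  assume "real CARD('n) > measurement_bound t c2 \<gamma> k CARD('p) (SNR_min z N) (MAR z)"
  then have n1: "2 * real k * L < real CARD('n)"
    and n2: "8 / (1 - t)\<^sup>2 / SNR_min z (real CARD('n) * \<sigma>\<^sup>2) * (2 * real k * L) < real CARD('n)"
    and n3: "((20 * c1)\<^sup>2 / t\<^sup>2 / MAR z * (2 * real k * L)) powr (\<gamma> / 2) < real CARD('n)"
    unfolding measurement_bound_def Max_triple_less_iff by (simp_all add: L_def N c2_def)
  \<comment> \<open>The first bound on \<open>n\<close>, together with \<open>n \<le> p\<close>, ensures that at most half of the columns are drawn.\<close>
  have "real (2 * k) \<le> 2 * real k * L"
    using \<open>1 \<le> L\<close> mult_left_mono[of 1 L "2 * real k"] by simp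
  also note n1
  also have "real CARD('n) \<le> real CARD('p)"
    using \<open>CARD('n) \<le> CARD('p)\<close> by simp
  finally have k_small: "2 * length z \<le> CARD('p)"
    unfolding of_nat_less_iff z(1) by simp
  define A where "A = sqrt 2 * (10 * worst_case_coherence X * sqrt (signal_energy z) * sqrt L)"
  define B where "B = sqrt 2 * (\<sigma> * sqrt (2 * L))"
  have lam: "lam = max (A / t) (B / (1 - t))"
    unfolding lam_def A_def B_def L_def N
    by (rule OST_threshold_eq) (use \<open>0 < \<sigma>\<close> \<open>CARD('p) \<ge> 128\<close> in auto)
  have "A / t \<le> lam" "B / (1 - t) \<le> lam"
    by (simp_all add: lam)
  then have "A + B \<le> lam * t + lam * (1 - t)"
    using \<open>0 < t\<close> \<open>t < 1\<close> by (intro add_mono) (simp_all add: pos_divide_le_eq)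
  then have AB: "A + B \<le> lam"
    by (simp add: algebra_simps)
  have "2 * (A / t) < signal_min z"
    unfolding A_def
    by (rule interference_level_lt_signal_min[OF \<open>0 < k\<close> _ \<open>0 < t\<close> min_pos energy_pos z(1) _
          \<open>\<gamma> = 0 \<or> 2 \<le> \<gamma>\<close> coherence_scaling n3]) (use \<open>1 \<le> L\<close> in auto)
  moreover have "2 * (B / (1 - t)) < signal_min z"
    unfolding B_def
    by (rule noise_level_lt_signal_min[OF \<open>0 < k\<close> _ \<open>0 < \<sigma>\<close> \<open>t < 1\<close> min_pos z(1) _ n2])
      (use \<open>1 \<le> L\<close> in auto)
  ultimately have lam_small: "2 * lam < signal_min z"
    by (simp add: lam max_def)
  have \<pi>_meas: "\<pi> \<in> measurable M (count_space UNIV)"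
    using indep by (auto simp: independent_pair_def indep_set_def indep_sets_def
        measurable_def split: bool.splits)
  have perm: "AE \<omega> in M. \<pi> \<omega> \<in> permutations_of_set UNIV"
  proof -
    have "AE xs in distr M (count_space UNIV) \<pi>. xs \<in> permutations_of_set UNIV"
      unfolding uniform_permutation by (simp add: AE_measure_pmf_iff)
    then show ?thesis
      by (subst (asm) AE_distr_iff[OF \<pi>_meas]) auto
  qed
  define bad_signal where "bad_signal i =
    {\<omega> \<in> space M. A < cmod (interference X i (sparse_signal z (\<pi> \<omega>)))}" for i
  define bad_noise where "bad_noise i = {\<omega> \<in> space M. B < cmod (cinner (column i X) (\<eta> \<omega>))}" for i
  have "prob {\<omega> \<in> space M. OST X (X *v sparse_signal z (\<pi> \<omega>) + \<eta> \<omega>) lam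
      \<noteq> true_model (sparse_signal z (\<pi> \<omega>))} \<le> real CARD('p) * (4 * exp (- 7 * L) + 4 * exp (- 2 * L))"
  proof (rule prob_le_union_bound)
    fix i :: 'p
    define T where "T = {xs. A < cmod (interference X i (sparse_signal z xs))}"
    have T: "bad_signal i = \<pi> -` T \<inter> space M"
      by (auto simp: bad_signal_def T_def)
    show "bad_signal i \<in> events"
      unfolding T using \<pi>_meas by (rule measurable_sets) simp
    have "prob (bad_signal i) = measure (distr M (count_space UNIV) \<pi>) T"
      unfolding T by (rule measure_distr[OF \<pi>_meas, symmetric]) simp
    also have "\<dots> \<le> 4 * exp (- 7 * L)"
      unfolding uniform_permutation T_def A_def
      by (rule interference_tail)
        (use coherence z(1) k_small energy_pos \<open>1 \<le> L\<close> \<open>k < CARD('n)\<close> \<open>CARD('p) \<ge> 128\<close> in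
          \<open>auto simp: coherence_property_def\<close>)
    finally show "prob (bad_signal i) \<le> 4 * exp (- 7 * L)" .
    have "0 < L"
      using \<open>1 \<le> L\<close> by simp
    note tail = noise_tail[OF noise \<open>0 < \<sigma>\<close> unit_columns[of i] this]
    note [measurable] = tail(1)
    show "bad_noise i \<in> events"
      unfolding bad_noise_def by measurable
    show "prob (bad_noise i) \<le> 4 * exp (- 2 * L)"
      using tail(2) by (simp add: bad_noise_def B_def)
  next
    have recovered: "OST X (X *v sparse_signal z (\<pi> \<omega>) + \<eta> \<omega>) lam = true_model (sparse_signal z (\<pi> \<omega>))"
      if \<omega>: "\<omega> \<in> space M" "\<pi> \<omega> \<in> permutations_of_set UNIV"
        and good: "\<And>i. \<omega> \<notin> bad_signal i" "\<And>i. \<omega> \<notin> bad_noise i" for \<omega>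
    proof (rule OST_eq_true_model[OF unit_columns _ _ AB])
      show "cmod (interference X i (sparse_signal z (\<pi> \<omega>))) \<le> A" for i
        using good(1)[of i] \<omega>(1) by (simp add: bad_signal_def)
      show "cmod (cinner (column i X) (\<eta> \<omega>)) \<le> B" for i
        using good(2)[of i] \<omega>(1) by (simp add: bad_noise_def)
      fix i assume "i \<in> true_model (sparse_signal z (\<pi> \<omega>))"
      then have "signal_min z \<le> cmod (sparse_signal z (\<pi> \<omega>) $ i)"
        using k_small z by (subst signal_min_sparse_signal[OF \<omega>(2)]) auto
      then show "2 * lam < cmod (sparse_signal z (\<pi> \<omega>) $ i)"
        using lam_small by simp
    qed
    show "AE \<omega> in M. \<omega> \<in> {\<omega> \<in> space M. OST X (X *v sparse_signal z (\<pi> \<omega>) + \<eta> \<omega>) lam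
        \<noteq> true_model (sparse_signal z (\<pi> \<omega>))} \<longrightarrow> \<omega> \<in> (\<Union>i. bad_signal i) \<union> (\<Union>i. bad_noise i)"
      using perm by eventually_elim (use recovered in blast)
  qed
  \<comment> \<open>The factor \<open>exp (- 7 L)\<close> is at most half of \<open>exp (- 2 L)\<close>, so the noise term dominates.\<close>
  also have "\<dots> \<le> real CARD('p) * (6 * exp (- 2 * L))"
  proof -
    have "2 \<le> exp L"
      using \<open>CARD('p) \<ge> 128\<close> by (simp add: exp_L)
    also have "exp L \<le> exp (5 * L)"
      using \<open>1 \<le> L\<close> by simp
    finally have "2 * exp (- 7 * L) \<le> exp (5 * L) * exp (- 7 * L)"
      by (intro mult_right_mono) auto
    also have "\<dots> = exp (- 2 * L)"
      by (simp flip: exp_add)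
    finally show ?thesis
      by (intro mult_left_mono) auto
  qed
  also have "exp (- 2 * L) = 1 / (real CARD('p))\<^sup>2"
    using exp_double[of L] by (simp add: exp_minus exp_L divide_inverse)
  finally show "prob {\<omega> \<in> space M. OST X (X *v sparse_signal z (\<pi> \<omega>) + \<eta> \<omega>) lam
      \<noteq> true_model (sparse_signal z (\<pi> \<omega>))} \<le> 6 / real CARD('p)"
    by (simp add: power2_eq_square)
qed

end
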